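(* Let $E$ be a Banach space. If $FBL[E]$ has the $\lambda$-Fatou property for some $\lambda\ge 1$, then $E$ does not contain a closed subspace isomorphic to $L_1[0,1]$.
   Context: All spaces are real. For a Banach space $E$ with dual $E^*$ and closed unit ball $B_E$, a function $f:E^*\to\mathbb R$ is positively homogeneous if $f(\lambda x^* )=\lambda f(x^* )$ for all $\lambda\ge 0$. For such $f$ put $$\|f\|_{FBL[E]}=\sup\Big\{\sum_{i=1}^m|f(x_i^* )| : m\in\mathbb N,\ x_1^*,\dots,x_m^*\in E^*,\ \sup_{x\in B_E}\sum_{i=1}^m|x_i^*(x)|\le 1\Big\}.$$ $H_1[E]$ is the Banach lattice of all positively homogeneous $f:E^*\to\mathbb R$ with $\|f\|_{FBL[E]}<\infty$, with this norm and pointwise order and lattice operations. The free Banach lattice $FBL[E]$ is the closed sublattice of $H_1[E]$ generated by the evaluations $\delta_x$, $x\in E$, where $\delta_x(x^* )=x^*(x)$. For $\lambda\ge 1$, a Banach lattice $X$ has the $\lambda$-Fatou property if for every (non-empty) upwards directed subset $A\subset X_+$ with supremum $b$ in $X$ one has $\|b\|\le\lambda\sup\{\|a\|:a\in A\}$. *)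

theory Defs
  imports "HOL-Analysis.Analysis" "HOL-Library.Function_Algebras"
begin

text \<open>The dual of \<open>E\<close> is the type \<open>'a \<Rightarrow>\<^sub>L real\<close>.  Order, \<open>sup\<close>, \<open>inf\<close> and the additive
  operations on functions are the pointwise ones.  Finite families of functionals are lists, and
  suprema are taken in \<^typ>\<open>ennreal\<close>, so the norm is defined for every function.\<close>

definition pos_homogeneous :: "('b::real_vector \<Rightarrow> real) \<Rightarrow> bool" where
  "pos_homogeneous f \<longleftrightarrow> (\<forall>c\<ge>0. \<forall>x. f (c *\<^sub>R x) = c * f x)"

definition FBL_norm :: "(('a::banach \<Rightarrow>\<^sub>L real) \<Rightarrow> real) \<Rightarrow> ennreal" where
  "FBL_norm f =
     (SUP \<phi>s \<in> {\<phi>s :: ('a \<Rightarrow>\<^sub>L real) list.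
                  (SUP x\<in>cball 0 1. \<Sum>\<phi>\<leftarrow>\<phi>s. ennreal \<bar>blinfun_apply \<phi> x\<bar>) \<le> 1}.
        \<Sum>\<phi>\<leftarrow>\<phi>s. ennreal \<bar>f \<phi>\<bar>)"

definition H1 :: "(('a::banach \<Rightarrow>\<^sub>L real) \<Rightarrow> real) set" where
  "H1 = {f. pos_homogeneous f \<and> FBL_norm f < \<infinity>}"

definition evaluation :: "'a::banach \<Rightarrow> ('a \<Rightarrow>\<^sub>L real) \<Rightarrow> real" where
  "evaluation x = (\<lambda>\<phi>. blinfun_apply \<phi> x)"

text \<open>Closedness refers to the norm of \<open>H1\<close>, not to any topology on the function type.\<close>

definition closed_sublattice :: "(('a::banach \<Rightarrow>\<^sub>L real) \<Rightarrow> real) set \<Rightarrow> bool" where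
  "closed_sublattice S \<longleftrightarrow>
     S \<subseteq> H1 \<and>
     0 \<in> S \<and> (\<forall>f\<in>S. \<forall>g\<in>S. f + g \<in> S) \<and> (\<forall>c. \<forall>f\<in>S. (\<lambda>\<phi>. c * f \<phi>) \<in> S) \<and>
     (\<forall>f\<in>S. \<forall>g\<in>S. sup f g \<in> S \<and> inf f g \<in> S) \<and>
     (\<forall>f\<in>H1. (\<forall>\<epsilon>>0. \<exists>g\<in>S. FBL_norm (f - g) < \<epsilon>) \<longrightarrow> f \<in> S)"

definition FBL :: "(('a::banach \<Rightarrow>\<^sub>L real) \<Rightarrow> real) set" where
  "FBL = {f \<in> H1. \<forall>S. closed_sublattice S \<and> range evaluation \<subseteq> S \<longrightarrow> f \<in> S}"

text \<open>A Banach lattice is given here by its carrier \<open>X\<close>, inside an ordered type, and its norm \<open>N\<close>.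
  Suprema are taken within \<open>X\<close>, so for \<open>FBL\<close> they need not be pointwise suprema.\<close>

definition directed_up :: "'b::order set \<Rightarrow> bool" where
  "directed_up A \<longleftrightarrow> A \<noteq> {} \<and> (\<forall>a\<in>A. \<forall>b\<in>A. \<exists>c\<in>A. a \<le> c \<and> b \<le> c)"

definition is_sup_in :: "'b::order set \<Rightarrow> 'b set \<Rightarrow> 'b \<Rightarrow> bool" where
  "is_sup_in X A b \<longleftrightarrow>
     b \<in> X \<and> (\<forall>a\<in>A. a \<le> b) \<and> (\<forall>c\<in>X. (\<forall>a\<in>A. a \<le> c) \<longrightarrow> b \<le> c)"

definition Fatou_property :: "real \<Rightarrow> 'b::{order,zero} set \<Rightarrow> ('b \<Rightarrow> ennreal) \<Rightarrow> bool" where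
  "Fatou_property l X N \<longleftrightarrow>
     (\<forall>A b. A \<subseteq> {a \<in> X. 0 \<le> a} \<and> directed_up A \<and> is_sup_in X A b
        \<longrightarrow> N b \<le> ennreal l * (SUP a\<in>A. N a))"

abbreviation unit_leb :: "real measure" where
  "unit_leb \<equiv> lebesgue_on {0..1}"

text \<open>\<open>L1_unit\<close> is the space of classes of Lebesgue integrable functions on the unit interval modulo
  equality almost everywhere; values of representatives outside the interval are irrelevant.\<close>

abbreviation L1_rel :: "(real \<Rightarrow> real) \<Rightarrow> (real \<Rightarrow> real) \<Rightarrow> bool" where
  "L1_rel \<equiv> \<lambda>f g. integrable unit_leb f \<and> integrable unit_leb g \<and> (AE t in unit_leb. f t = g t)"

quotient_type L1_unit = "real \<Rightarrow> real" / partial: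
  L1_rel
proof (rule part_equivpI)
  show "\<exists>f. L1_rel f f"
    by (rule exI[of _ "\<lambda>_. 0"]) simp
  show "symp L1_rel"
    by (rule sympI) (auto elim: AE_mp)
  show "transp L1_rel"
  proof (rule transpI, elim conjE, intro conjI)
    fix f g h :: "real \<Rightarrow> real"
    assume "AE t in unit_leb. f t = g t" "AE t in unit_leb. g t = h t"
    then show "AE t in unit_leb. f t = h t" by eventually_elim simp
  qed
qed

instantiation L1_unit :: real_normed_vector
begin

lift_definition zero_L1_unit :: L1_unit is "\<lambda>_. 0" by simp

lift_definition plus_L1_unit :: "L1_unit \<Rightarrow> L1_unit \<Rightarrow> L1_unit" is "\<lambda>f g t. f t + g t"
proof (elim conjE, intro conjI)
  fix f f' g g' :: "real \<Rightarrow> real"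
  assume "AE t in unit_leb. f t = f' t" "AE t in unit_leb. g t = g' t"
  then show "AE t in unit_leb. f t + g t = f' t + g' t" by eventually_elim simp
qed (simp_all)

lift_definition uminus_L1_unit :: "L1_unit \<Rightarrow> L1_unit" is "\<lambda>f t. - f t"
  by auto

lift_definition minus_L1_unit :: "L1_unit \<Rightarrow> L1_unit \<Rightarrow> L1_unit" is "\<lambda>f g t. f t - g t"
proof (elim conjE, intro conjI)
  fix f f' g g' :: "real \<Rightarrow> real"
  assume "AE t in unit_leb. f t = f' t" "AE t in unit_leb. g t = g' t"
  then show "AE t in unit_leb. f t - g t = f' t - g' t" by eventually_elim simp
qed (simp_all)

lift_definition scaleR_L1_unit :: "real \<Rightarrow> L1_unit \<Rightarrow> L1_unit" is "\<lambda>c f t. c * f t"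
  by auto

lift_definition norm_L1_unit :: "L1_unit \<Rightarrow> real" is "\<lambda>f. \<integral>t. \<bar>f t\<bar> \<partial>unit_leb"
proof (elim conjE)
  fix f g :: "real \<Rightarrow> real"
  assume i: "integrable unit_leb f" "integrable unit_leb g" and "AE t in unit_leb. f t = g t"
  then have "AE t in unit_leb. \<bar>f t\<bar> = \<bar>g t\<bar>" by auto
  then show "(\<integral>t. \<bar>f t\<bar> \<partial>unit_leb) = (\<integral>t. \<bar>g t\<bar> \<partial>unit_leb)"
    using i by (intro integral_cong_AE) auto
qed

definition sgn_L1_unit :: "L1_unit \<Rightarrow> L1_unit" where
  "sgn_L1_unit x = scaleR (inverse (norm x)) x"

definition dist_L1_unit :: "L1_unit \<Rightarrow> L1_unit \<Rightarrow> real" where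
  "dist_L1_unit x y = norm (x - y)"

definition uniformity_L1_unit :: "(L1_unit \<times> L1_unit) filter" where
  "uniformity_L1_unit = (INF e\<in>{0 <..}. principal {(x, y). dist x y < e})"

definition open_L1_unit :: "L1_unit set \<Rightarrow> bool" where
  "open_L1_unit U \<longleftrightarrow> (\<forall>x\<in>U. eventually (\<lambda>(x', y). x' = x \<longrightarrow> y \<in> U) uniformity)"

instance
proof
  fix x y z :: L1_unit and a b :: real
  show "x + y + z = x + (y + z)" by transfer (simp add: add.assoc)
  show "x + y = y + x" by transfer (simp add: add.commute)
  show "0 + x = x" by transfer simp
  show "- x + x = 0" by transfer simp
  show "x - y = x + - y" by transfer simp
  show "a *\<^sub>R (x + y) = a *\<^sub>R x + a *\<^sub>R y" by transfer (simp add: distrib_left)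
  show "(a + b) *\<^sub>R x = a *\<^sub>R x + b *\<^sub>R x" by transfer (simp add: distrib_right)
  show "a *\<^sub>R b *\<^sub>R x = (a * b) *\<^sub>R x" by transfer (simp add: mult.assoc)
  show "1 *\<^sub>R x = x" by transfer simp
  show "norm x = 0 \<longleftrightarrow> x = 0"
    by transfer (auto simp: integral_nonneg_eq_0_iff_AE)
  show "norm (x + y) \<le> norm x + norm y"
  proof transfer
    fix f g :: "real \<Rightarrow> real"
    assume "integrable unit_leb f \<and> integrable unit_leb f \<and> (AE t in unit_leb. f t = f t)"
      and "integrable unit_leb g \<and> integrable unit_leb g \<and> (AE t in unit_leb. g t = g t)"
    then have i: "integrable unit_leb f" "integrable unit_leb g" by auto
    then have "(\<integral>t. \<bar>f t + g t\<bar> \<partial>unit_leb) \<le> (\<integral>t. \<bar>f t\<bar> + \<bar>g t\<bar> \<partial>unit_leb)"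
      by (intro integral_mono) auto
    also have "\<dots> = (\<integral>t. \<bar>f t\<bar> \<partial>unit_leb) + (\<integral>t. \<bar>g t\<bar> \<partial>unit_leb)"
      using i by simp
    finally show "(\<integral>t. \<bar>f t + g t\<bar> \<partial>unit_leb)
        \<le> (\<integral>t. \<bar>f t\<bar> \<partial>unit_leb) + (\<integral>t. \<bar>g t\<bar> \<partial>unit_leb)" .
  qed
  show "norm (a *\<^sub>R x) = \<bar>a\<bar> * norm x" by transfer (simp add: abs_mult)
qed (simp_all add: sgn_L1_unit_def dist_L1_unit_def uniformity_L1_unit_def open_L1_unit_def)

end

text \<open>Isomorphic in the sense of Banach spaces: a linear homeomorphism, not necessarily isometric.\<close>

definition isomorphic_subspace ::
    "'b::real_normed_vector itself \<Rightarrow> 'a::real_normed_vector set \<Rightarrow> bool" where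
  "isomorphic_subspace _ F \<longleftrightarrow>
     subspace F \<and> (\<exists>(T :: 'b \<Rightarrow> 'a) S. linear T \<and> homeomorphism UNIV F T S)"

end

theory Submission imports Defs
begin

text \<open>
  Suppose that \<open>E\<close> contains an isomorphic copy of \<open>L\<^sub>1[0,1]\<close>, and let \<open>y m i\<close> be the image of the indicator
  function of the \<open>i\<close>-th dyadic interval of length \<open>1 / 2^m\<close>.  The functions
  \<open>s m = (\<Sum>i<2^m. \<bar>\<delta>(y m i)\<bar>)\<close> of the free Banach lattice increase with \<open>m\<close>.  Their norms are at most
  \<open>(\<Sum>i<2^m. norm (y m i))\<close>, hence at most a bound \<open>C\<close> for the norm of the
  embedding.

  Although this sequence is bounded in norm, it behaves like one that tends to infinity: for every positive
  element \<open>b\<close> of the free Banach lattice, the increasing sequence \<open>inf b (s m)\<close> has supremum \<open>b\<close>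
  (\<open>is_sup_in_FBL_inf_level_sum\<close>).  Taking for \<open>b\<close> large multiples of \<open>\<bar>\<delta>(y 0 0)\<bar>\<close>, one sees that a directed
  set of positive elements of norm at most \<open>C\<close> can have a supremum of arbitrarily large norm, which excludes the
  Fatou property for every constant.

  The supremum is that large because elements of the free Banach lattice are weak-star continuous on balls of
  the dual (\<open>FBL_weak_star_continuous_on_balls\<close>), while the \<open>L\<^sub>1\<close> norm, the pointwise limit of the level sums
  when \<open>E\<close> is \<open>L\<^sub>1[0,1]\<close> itself and the dual is \<open>L\<^sub>\<infinity>\<close>, is not: adding a large multiple of a rapidly
  oscillating function hardly changes a functional in the weak-star sense but makes its \<open>L\<^sub>1\<close> norm large.
  Hence every functional \<open>\<phi>\<close> is, within a ball, a weak-star limit of functionals \<open>\<psi>\<close> with \<open>s m \<psi> \<ge> b \<phi>\<close>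
  for some \<open>m\<close>, and at these an upper bound of the sequence is at least the minimum of \<open>b \<psi>\<close> and \<open>b \<phi>\<close>.

  In a general space \<open>E\<close> oscillating functions on the copy of \<open>L\<^sub>1\<close> must be extended to \<open>E\<close> by the Hahn-Banach
  theorem, and the extensions need not be close to \<open>0\<close>.  Differences of two of them can be, by a pigeonhole
  argument (\<open>small_oscillating_functional\<close>); rows of a Hadamard matrix provide sign patterns whose
  differences still have a fixed size.
\<close>

section \<open>Extension of functionals\<close>

text \<open>The Hahn-Banach theorem, with a functional on a subspace replaced by its graph.  In this form the
  extensions are ordered by inclusion of sets, and the bound \<open>t \<le> K * norm x\<close> on a linear subspace of the
  product already makes it single valued: applied at \<open>x = 0\<close> to a difference of two values and to its
  negative, it forces them to agree.\<close>

lemma hahn_banach_graph: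
  fixes G0 :: "('a::real_normed_vector \<times> real) set"
  assumes sub0: "subspace G0" and le0: "\<And>x t. (x, t) \<in> G0 \<Longrightarrow> t \<le> K * norm x" and K: "K \<ge> 0"
  obtains \<phi> :: "'a \<Rightarrow>\<^sub>L real" where "norm \<phi> \<le> K" "\<And>x t. (x, t) \<in> G0 \<Longrightarrow> blinfun_apply \<phi> x = t"
proof -
  define \<G> where "\<G> = {G. subspace G \<and> G0 \<subseteq> G \<and> (\<forall>(x, t)\<in>G. t \<le> K * norm x)}"
  have "\<exists>M\<in>\<G>. \<forall>X\<in>\<G>. M \<subseteq> X \<longrightarrow> X = M"
  proof (rule subset_Zorn_nonempty)
    show "\<G> \<noteq> {}" using sub0 le0 by (auto simp: \<G>_def)
  next
    fix \<C> assume ne: "\<C> \<noteq> {}" and ch: "subset.chain \<G> \<C>"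
    then have sub: "\<And>G. G \<in> \<C> \<Longrightarrow> subspace G \<and> G0 \<subseteq> G \<and> (\<forall>(x, t)\<in>G. t \<le> K * norm x)"
      by (auto simp: subset.chain_def \<G>_def)
    have tot: "\<And>G H. G \<in> \<C> \<Longrightarrow> H \<in> \<C> \<Longrightarrow> G \<subseteq> H \<or> H \<subseteq> G"
      using ch by (auto simp: subset_chain_def)
    have "subspace (\<Union>\<C>)"
    proof (rule subspaceI)
      show "0 \<in> \<Union>\<C>" using ne sub subspace_0 by blast
    next
      fix u v assume "u \<in> \<Union>\<C>" "v \<in> \<Union>\<C>"
      then obtain G H where "G \<in> \<C>" "u \<in> G" "H \<in> \<C>" "v \<in> H" by blast
      with tot[of G H] obtain L where "L \<in> \<C>" "u \<in> L" "v \<in> L" by blast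
      then show "u + v \<in> \<Union>\<C>" using sub subspace_add by blast
    next
      fix c :: real and u assume "u \<in> \<Union>\<C>"
      then show "c *\<^sub>R u \<in> \<Union>\<C>" using sub subspace_scale by blast
    qed
    then show "\<Union>\<C> \<in> \<G>" using ne sub by (fastforce simp: \<G>_def)
  qed
  then obtain M where "M \<in> \<G>" and max: "\<And>X. X \<in> \<G> \<Longrightarrow> M \<subseteq> X \<Longrightarrow> X = M"
    by blast
  then have M: "subspace M" "G0 \<subseteq> M" and le: "\<And>x t. (x, t) \<in> M \<Longrightarrow> t \<le> K * norm x"
    by (auto simp: \<G>_def)
  have ex: "\<exists>c. (x0, c) \<in> M" for x0
  proof -
    \<comment> \<open>The value at \<open>x0\<close> must lie between all lower bounds on the left of \<open>step\<close> and all upper bounds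
      on the right; the least admissible choice is taken.\<close>
    define c where "c = (SUP (x, t)\<in>M. t - K * norm (x - x0))"
    have step: "t - K * norm (x - x0) \<le> K * norm (x' + x0) - t'"
      if "(x, t) \<in> M" "(x', t') \<in> M" for x t x' t'
    proof -
      have "t + t' \<le> K * norm (x + x')" using le subspace_add[OF M(1) that] by simp
      also have "\<dots> \<le> K * (norm (x - x0) + norm (x' + x0))"
        using norm_triangle_ineq[of "x - x0" "x' + x0"] K by (intro mult_left_mono) (auto simp: algebra_simps)
      finally show ?thesis by (simp add: algebra_simps)
    qed
    have zero: "(0, 0) \<in> M" using subspace_0[OF M(1)] by (simp add: zero_prod_def)
    have bdd: "bdd_above ((\<lambda>(x, t). t - K * norm (x - x0)) ` M)"
      using step[OF _ zero] by (intro bdd_aboveI[where M = "K * norm (0 + x0) - 0"]) auto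
    have lower: "t - K * norm (x - x0) \<le> c" if "(x, t) \<in> M" for x t
      unfolding c_def using cSUP_upper[OF that bdd] by simp
    have upper: "c \<le> K * norm (x' + x0) - t'" if "(x', t') \<in> M" for x' t'
      unfolding c_def using zero step[OF _ that] by (intro cSUP_least) auto
    define X where "X = span (insert (x0, c) M)"
    have "t \<le> K * norm x" if "(x, t) \<in> X" for x t
    proof -
      have "(x, t) \<in> {u. \<exists>k. u - k *\<^sub>R (x0, c) \<in> M}"
        using that unfolding X_def span_insert span_eq_iff[THEN iffD2, OF M(1)] .
      then obtain k where k: "(x - k *\<^sub>R x0, t - k * c) \<in> M" by auto
      have sc: "((1/j) *\<^sub>R (x - k *\<^sub>R x0), (1/j) * (t - k * c)) \<in> M" for j
        using subspace_scale[OF M(1) k, of "1/j"] by simp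
      \<comment> \<open>After scaling the coefficient of \<open>x0\<close> to \<open>1\<close> or \<open>-1\<close>, these are \<open>upper\<close> and \<open>lower\<close>.\<close>
      consider "k = 0" | "k > 0" | "k < 0" by linarith
      then show ?thesis
      proof cases
        case 1 then show ?thesis using le[OF k] by simp
      next
        case 2
        have "norm ((1/k) *\<^sub>R (x - k *\<^sub>R x0) + x0) = norm x / k"
          using 2 by (simp add: algebra_simps)
        then have "c \<le> K * (norm x / k) - (1/k) * (t - k * c)"
          using upper[OF sc[of k]] by simp
        then show ?thesis using 2 by (simp add: field_simps)
      next
        case 3
        have "norm ((1/(-k)) *\<^sub>R (x - k *\<^sub>R x0) - x0) = norm x / (-k)"
          using 3 by (simp add: algebra_simps)
        then have "(1/(-k)) * (t - k * c) - K * (norm x / (-k)) \<le> c"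
          using lower[OF sc[of "-k"]] by simp
        then show ?thesis using 3 by (simp add: field_simps)
      qed
    qed
    moreover have "M \<subseteq> X" "(x0, c) \<in> X" by (auto simp: X_def intro: span_base)
    moreover have "subspace X" by (simp add: X_def)
    ultimately have "X = M" using max[of X] M(2) by (auto simp: \<G>_def)
    then show ?thesis using \<open>(x0, c) \<in> X\<close> by auto
  qed
  have abs_le: "\<bar>t\<bar> \<le> K * norm x" if "(x, t) \<in> M" for x t
    using le[OF that] le[of "-x" "-t"] subspace_neg[OF M(1) that] by simp
  have uniq: "s = t" if "(x, s) \<in> M" "(x, t) \<in> M" for x s t
    using abs_le[of 0 "s - t"] subspace_diff[OF M(1) that] by simp
  define f where "f x = (THE t. (x, t) \<in> M)" for x
  have fM: "(x, f x) \<in> M" for x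
    unfolding f_def using ex[of x] uniq by (metis theI)
  have f_eq: "f x = t" if "(x, t) \<in> M" for x t using uniq fM that by blast
  have "bounded_linear f"
  proof (rule bounded_linear_intro)
    show "f (x + y) = f x + f y" for x y
      using subspace_add[OF M(1) fM[of x] fM[of y]] by (intro f_eq) simp
    show "f (r *\<^sub>R x) = r *\<^sub>R f x" for r x
      using subspace_scale[OF M(1) fM[of x], of r] by (intro f_eq) simp
    show "norm (f x) \<le> norm x * K" for x using abs_le[OF fM] by (simp add: mult.commute)
  qed
  then have app: "blinfun_apply (Blinfun f) = f" by (rule bounded_linear_Blinfun_apply)
  show thesis
  proof (rule that)
    show "norm (Blinfun f) \<le> K"
      using abs_le[OF fM] K by (intro norm_blinfun_bound) (auto simp: app)
    show "blinfun_apply (Blinfun f) x = t" if "(x, t) \<in> G0" for x t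
      using that M(2) f_eq by (auto simp: app)
  qed
qed

text \<open>Helly's condition for solving the moment problem \<open>\<phi> (y i) = c i\<close> with \<open>norm \<phi> \<le> K\<close>: it says that the pairs
  formed from linear combinations of the \<open>y i\<close> and the same combinations of the \<open>c i\<close> form a graph to which the
  preceding extension theorem applies.\<close>

lemma functional_with_prescribed_values:
  fixes y :: "'i \<Rightarrow> 'a::real_normed_vector"
  assumes "finite I" "K \<ge> 0" and le: "\<And>a. (\<Sum>i\<in>I. a i * c i) \<le> K * norm (\<Sum>i\<in>I. a i *\<^sub>R y i)"
  obtains \<phi> :: "'a \<Rightarrow>\<^sub>L real" where "norm \<phi> \<le> K" "\<And>i. i \<in> I \<Longrightarrow> blinfun_apply \<phi> (y i) = c i"
proof -
  define g where "g a = ((\<Sum>i\<in>I. a i *\<^sub>R y i), (\<Sum>i\<in>I. a i * c i))" for a :: "'i \<Rightarrow> real"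
  have sub: "subspace (range g)"
  proof (rule subspaceI)
    have "g (\<lambda>_. 0) = 0" by (simp add: g_def zero_prod_def)
    then show "0 \<in> range g" by (metis rangeI)
  next
    fix u v assume "u \<in> range g" "v \<in> range g"
    then obtain a b where "u = g a" "v = g b" by blast
    then have "u + v = g (\<lambda>i. a i + b i)"
      by (simp add: g_def sum.distrib scaleR_add_left distrib_right)
    then show "u + v \<in> range g" by simp
  next
    fix r :: real and u assume "u \<in> range g"
    then obtain a where "u = g a" by blast
    then have "r *\<^sub>R u = g (\<lambda>i. r * a i)"
      by (simp add: g_def scaleR_sum_right sum_distrib_left mult.assoc)
    then show "r *\<^sub>R u \<in> range g" by simp
  qed
  obtain \<phi> :: "'a \<Rightarrow>\<^sub>L real" where \<phi>: "norm \<phi> \<le> K" "\<And>x t. (x, t) \<in> range g \<Longrightarrow> blinfun_apply \<phi> x = t"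
    using hahn_banach_graph[OF sub _ \<open>K \<ge> 0\<close>] le by (auto simp: g_def)
  show thesis
  proof (rule that[OF \<phi>(1)])
    fix i assume i: "i \<in> I"
    have "g (\<lambda>j. if j = i then 1 else 0) = (y i, c i)"
      using i assms(1) by (simp add: g_def if_distrib[of "\<lambda>r. r *\<^sub>R _"] if_distrib[of "\<lambda>r. r * _"] cong: if_cong)
    then show "blinfun_apply \<phi> (y i) = c i" by (intro \<phi>(2)) (metis rangeI)
  qed
qed

section \<open>Sign patterns and pigeonholes\<close>

text \<open>Sylvester's doubling construction.  The rows serve as a family of sign vectors of which any two
  differ in exactly half of the coordinates, as do the Rademacher functions.\<close>

lemma hadamard_matrix_exists:
  obtains W :: "nat \<Rightarrow> nat \<Rightarrow> real" where
    "\<And>k i. W k i \<in> {1, -1}"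
    "\<And>k l. k < 2^m \<Longrightarrow> l < 2^m \<Longrightarrow> k \<noteq> l \<Longrightarrow> (\<Sum>i<2^m. W k i * W l i) = 0"
proof -
  have "\<exists>W :: nat \<Rightarrow> nat \<Rightarrow> real. (\<forall>k i. W k i \<in> {1, -1}) \<and>
     (\<forall>k<2^m. \<forall>l<2^m. k \<noteq> l \<longrightarrow> (\<Sum>i<2^m. W k i * W l i) = 0)"
  proof (induction m)
    case 0 show ?case by (intro exI[of _ "\<lambda>_ _. 1"]) auto
  next
    case (Suc m)
    define n :: nat where "n = 2^m"
    have n: "n > 0" by (simp add: n_def)
    obtain W :: "nat \<Rightarrow> nat \<Rightarrow> real" where W: "\<And>k i. W k i \<in> {1, -1}"
      and orth: "\<And>k l. k < n \<Longrightarrow> l < n \<Longrightarrow> k \<noteq> l \<Longrightarrow> (\<Sum>i<n. W k i * W l i) = 0"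
      using Suc unfolding n_def by blast
    \<comment> \<open>The block matrix with rows \<open>(W, W)\<close> and \<open>(W, -W)\<close>.\<close>
    define V where "V k i = W (k mod n) (i mod n) * (if k \<ge> n \<and> i \<ge> n then -1 else 1)" for k i
    have V: "V k i \<in> {1, -1}" for k i using W[of "k mod n" "i mod n"] by (auto simp: V_def)
    have "(\<Sum>i<n+n. V k i * V l i) = 0" if kl: "k < n + n" "l < n + n" "k \<noteq> l" for k l
    proof -
      define s where "s = (\<Sum>i<n. W (k mod n) i * W (l mod n) i)"
      have "(\<Sum>i<n+n. V k i * V l i) = (\<Sum>i<n. V k i * V l i) + (\<Sum>i<n. V k (n+i) * V l (n+i))"
        by (simp add: lessThan_atLeast0 sum.atLeastLessThan_concat[of 0 n "n+n", symmetric]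
            sum.shift_bounds_nat_ivl[of _ 0 n n, simplified] add.commute)
      also have "(\<Sum>i<n. V k i * V l i) = s"
        unfolding s_def by (intro sum.cong) (auto simp: V_def)
      also have "(\<Sum>i<n. V k (n+i) * V l (n+i)) = (if k \<ge> n \<longleftrightarrow> l \<ge> n then s else -s)"
        unfolding s_def by (auto simp: V_def sum_negf[symmetric] intro!: sum.cong)
      finally have eq: "(\<Sum>i<n+n. V k i * V l i) = s + (if k \<ge> n \<longleftrightarrow> l \<ge> n then s else -s)" .
      show ?thesis
      proof (cases "k \<ge> n \<longleftrightarrow> l \<ge> n")
        case True
        have "k mod n \<noteq> l mod n"
        proof (cases "k \<ge> n")
          case True
          then have "k mod n = k - n" "l mod n = l - n"
            using kl \<open>k \<ge> n \<longleftrightarrow> l \<ge> n\<close> by (auto simp: le_mod_geq)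
          then show ?thesis using kl True \<open>k \<ge> n \<longleftrightarrow> l \<ge> n\<close> by auto
        qed (use kl \<open>k \<ge> n \<longleftrightarrow> l \<ge> n\<close> in auto)
        then have "s = 0" unfolding s_def using n by (intro orth) auto
        then show ?thesis using eq by simp
      qed (use eq in auto)
    qed
    then show ?case using V by (intro exI[of _ V]) (auto simp: n_def mult_2)
  qed
  then show thesis using that by blast
qed

text \<open>Total boundedness of a cube in finitely many dimensions: rounding down to multiples of \<open>\<delta>\<close> leaves only
  finitely many cells, so two of sufficiently many points share one.  The number \<open>N\<close> is fixed before the
  points are, which lets the points be chosen in dependence on it.\<close>

lemma pigeonhole_close_pair:
  fixes R \<delta> :: real
  assumes "finite F" "\<delta> > 0"
  obtains N :: nat where
    "\<And>z :: nat \<Rightarrow> 'a \<Rightarrow> real. (\<And>k x. k < N \<Longrightarrow> x \<in> F \<Longrightarrow> \<bar>z k x\<bar> \<le> R) \<Longrightarrow>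
       \<exists>k<N. \<exists>l<N. k \<noteq> l \<and> (\<forall>x\<in>F. \<bar>z k x - z l x\<bar> < \<delta>)"
proof -
  define C where "C = (\<Pi>\<^sub>E x\<in>F. {\<lfloor>-R/\<delta>\<rfloor>..\<lfloor>R/\<delta>\<rfloor>})"
  have finC: "finite C" using assms by (auto simp: C_def intro: finite_PiE)
  show thesis
  proof (rule that[of "Suc (card C)"])
    fix z :: "nat \<Rightarrow> 'a \<Rightarrow> real" assume z: "\<And>k x. k < Suc (card C) \<Longrightarrow> x \<in> F \<Longrightarrow> \<bar>z k x\<bar> \<le> R"
    define q where "q k = (\<lambda>x\<in>F. \<lfloor>z k x / \<delta>\<rfloor>)" for k
    have "q k \<in> C" if "k < Suc (card C)" for k
      unfolding q_def C_def using z[OF that] \<open>\<delta> > 0\<close>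
      by (auto simp: abs_le_iff intro!: floor_mono divide_right_mono)
         (smt (verit) divide_right_mono floor_mono minus_divide_left)+
    then have "q ` {..<Suc (card C)} \<subseteq> C" by blast
    then have "\<not> inj_on q {..<Suc (card C)}"
      using card_inj_on_le[OF _ _ finC, of q "{..<Suc (card C)}"] by auto
    then obtain k l where kl: "k < Suc (card C)" "l < Suc (card C)" "k \<noteq> l" "q k = q l"
      by (auto simp: inj_on_def)
    have "\<bar>z k x - z l x\<bar> < \<delta>" if "x \<in> F" for x
    proof -
      have "\<lfloor>z k x / \<delta>\<rfloor> = \<lfloor>z l x / \<delta>\<rfloor>" using fun_cong[OF kl(4), of x] that by (simp add: q_def)
      then have "\<bar>z k x / \<delta> - z l x / \<delta>\<bar> < 1" by linarith
      then show ?thesis using \<open>\<delta> > 0\<close> by (simp add: diff_divide_distrib[symmetric] abs_divide)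
    qed
    then show "\<exists>k<Suc (card C). \<exists>l<Suc (card C). k \<noteq> l \<and> (\<forall>x\<in>F. \<bar>z k x - z l x\<bar> < \<delta>)"
      using kl by blast
  qed
qed

section \<open>The norm and the lattice operations of the free Banach lattice\<close>

text \<open>By homogeneity the supremum over the unit ball in the definition of the norm becomes an inequality at
  every vector, which can be summed over vectors of any norm.\<close>

definition admissible :: "('a::banach \<Rightarrow>\<^sub>L real) list \<Rightarrow> bool" where
  "admissible \<phi>s \<longleftrightarrow> (\<forall>x. (\<Sum>\<phi>\<leftarrow>\<phi>s. ennreal \<bar>blinfun_apply \<phi> x\<bar>) \<le> ennreal (norm x))"

lemma admissible_iff:
  "admissible \<phi>s \<longleftrightarrow> (SUP x\<in>cball 0 1. \<Sum>\<phi>\<leftarrow>\<phi>s. ennreal \<bar>blinfun_apply \<phi> x\<bar>) \<le> 1"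
proof
  assume *: "admissible \<phi>s"
  show "(SUP x\<in>cball 0 1. \<Sum>\<phi>\<leftarrow>\<phi>s. ennreal \<bar>blinfun_apply \<phi> x\<bar>) \<le> 1"
  proof (rule SUP_least)
    fix x :: 'a assume "x \<in> cball 0 1"
    then have "ennreal (norm x) \<le> 1" by simp
    then show "(\<Sum>\<phi>\<leftarrow>\<phi>s. ennreal \<bar>blinfun_apply \<phi> x\<bar>) \<le> 1"
      using * order_trans unfolding admissible_def by blast
  qed
next
  assume *: "(SUP x\<in>cball 0 1. \<Sum>\<phi>\<leftarrow>\<phi>s. ennreal \<bar>blinfun_apply \<phi> x\<bar>) \<le> 1"
  show "admissible \<phi>s"
    unfolding admissible_def
  proof
    fix x :: 'a
    define u where "u = (1 / norm x) *\<^sub>R x"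
    have x: "x = norm x *\<^sub>R u" by (simp add: u_def)
    have "(\<Sum>\<phi>\<leftarrow>\<phi>s. ennreal \<bar>blinfun_apply \<phi> u\<bar>) \<le> 1"
      using * by (auto simp: SUP_le_iff u_def)
    then have "ennreal (norm x) * (\<Sum>\<phi>\<leftarrow>\<phi>s. ennreal \<bar>blinfun_apply \<phi> u\<bar>) \<le> ennreal (norm x) * 1"
      by (intro mult_left_mono) auto
    also have "ennreal (norm x) * (\<Sum>\<phi>\<leftarrow>\<phi>s. ennreal \<bar>blinfun_apply \<phi> u\<bar>) =
        (\<Sum>\<phi>\<leftarrow>\<phi>s. ennreal \<bar>blinfun_apply \<phi> (norm x *\<^sub>R u)\<bar>)"
      by (simp add: sum_list_const_mult[symmetric] blinfun.scaleR_right abs_mult ennreal_mult del: sum_list_ennreal)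
    finally show "(\<Sum>\<phi>\<leftarrow>\<phi>s. ennreal \<bar>blinfun_apply \<phi> x\<bar>) \<le> ennreal (norm x)"
      using x by simp
  qed
qed

lemma FBL_norm_alt: "FBL_norm f = (SUP \<phi>s\<in>Collect admissible. \<Sum>\<phi>\<leftarrow>\<phi>s. ennreal \<bar>f \<phi>\<bar>)"
  by (simp add: FBL_norm_def admissible_iff[abs_def])

lemma sum_le_FBL_norm: "admissible \<phi>s \<Longrightarrow> (\<Sum>\<phi>\<leftarrow>\<phi>s. ennreal \<bar>f \<phi>\<bar>) \<le> FBL_norm f"
  unfolding FBL_norm_alt by (intro SUP_upper) simp

lemma FBL_norm_leI:
  "(\<And>\<phi>s. admissible \<phi>s \<Longrightarrow> (\<Sum>\<phi>\<leftarrow>\<phi>s. ennreal \<bar>f \<phi>\<bar>) \<le> B) \<Longrightarrow> FBL_norm f \<le> B"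
  unfolding FBL_norm_alt by (intro SUP_least) simp

lemma FBL_norm_add_le:
  assumes "\<And>\<phi>. \<bar>h \<phi>\<bar> \<le> \<bar>f \<phi>\<bar> + \<bar>g \<phi>\<bar>"
  shows "FBL_norm h \<le> FBL_norm f + FBL_norm g"
proof (rule FBL_norm_leI)
  fix \<phi>s :: "('a \<Rightarrow>\<^sub>L real) list" assume ad: "admissible \<phi>s"
  have "(\<Sum>\<phi>\<leftarrow>\<phi>s. ennreal \<bar>h \<phi>\<bar>) \<le> (\<Sum>\<phi>\<leftarrow>\<phi>s. ennreal \<bar>f \<phi>\<bar> + ennreal \<bar>g \<phi>\<bar>)"
    using assms by (intro sum_list_mono) (simp add: ennreal_plus[symmetric] ennreal_leI del: ennreal_plus)
  also have "\<dots> = (\<Sum>\<phi>\<leftarrow>\<phi>s. ennreal \<bar>f \<phi>\<bar>) + (\<Sum>\<phi>\<leftarrow>\<phi>s. ennreal \<bar>g \<phi>\<bar>)"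
    by (rule sum_list_addf)
  also have "\<dots> \<le> FBL_norm f + FBL_norm g"
    using ad by (intro add_mono sum_le_FBL_norm)
  finally show "(\<Sum>\<phi>\<leftarrow>\<phi>s. ennreal \<bar>h \<phi>\<bar>) \<le> FBL_norm f + FBL_norm g" .
qed

lemma FBL_norm_cmult_le: "FBL_norm (\<lambda>\<phi>. c * f \<phi>) \<le> ennreal \<bar>c\<bar> * FBL_norm f"
proof (rule FBL_norm_leI)
  fix \<phi>s :: "('a \<Rightarrow>\<^sub>L real) list" assume ad: "admissible \<phi>s"
  have "(\<Sum>\<phi>\<leftarrow>\<phi>s. ennreal \<bar>c * f \<phi>\<bar>) = ennreal \<bar>c\<bar> * (\<Sum>\<phi>\<leftarrow>\<phi>s. ennreal \<bar>f \<phi>\<bar>)"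
    by (simp add: sum_list_const_mult[symmetric] abs_mult ennreal_mult del: sum_list_ennreal)
  also have "\<dots> \<le> ennreal \<bar>c\<bar> * FBL_norm f"
    using ad by (intro mult_left_mono sum_le_FBL_norm) auto
  finally show "(\<Sum>\<phi>\<leftarrow>\<phi>s. ennreal \<bar>c * f \<phi>\<bar>) \<le> ennreal \<bar>c\<bar> * FBL_norm f" .
qed

text \<open>Summing an admissible family first over its members and then over \<open>I\<close> gives the bound.  It depends
  on the sizes of the vectors only, and it is what keeps the norms of the level sums below bounded.\<close>

lemma FBL_norm_le_sum_norms:
  assumes "\<And>\<phi>. \<bar>f \<phi>\<bar> \<le> (\<Sum>i\<in>I. \<bar>blinfun_apply \<phi> (y i)\<bar>)"
  shows "FBL_norm f \<le> ennreal (\<Sum>i\<in>I. norm (y i))"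
proof (rule FBL_norm_leI)
  fix \<phi>s :: "('a \<Rightarrow>\<^sub>L real) list" assume ad: "admissible \<phi>s"
  have "(\<Sum>\<phi>\<leftarrow>\<phi>s. ennreal \<bar>f \<phi>\<bar>) \<le> (\<Sum>\<phi>\<leftarrow>\<phi>s. \<Sum>i\<in>I. ennreal \<bar>blinfun_apply \<phi> (y i)\<bar>)"
    using assms by (intro sum_list_mono) (simp add: sum_ennreal ennreal_leI)
  also have "\<dots> = (\<Sum>i\<in>I. \<Sum>\<phi>\<leftarrow>\<phi>s. ennreal \<bar>blinfun_apply \<phi> (y i)\<bar>)"
    by (induction \<phi>s) (simp_all add: sum.distrib)
  also have "\<dots> \<le> (\<Sum>i\<in>I. ennreal (norm (y i)))"
    using ad by (intro sum_mono) (auto simp: admissible_def)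
  also have "\<dots> = ennreal (\<Sum>i\<in>I. norm (y i))" by (simp add: sum_ennreal)
  finally show "(\<Sum>\<phi>\<leftarrow>\<phi>s. ennreal \<bar>f \<phi>\<bar>) \<le> ennreal (\<Sum>i\<in>I. norm (y i))" .
qed

text \<open>A single functional of norm at most one is an admissible family.  Hence convergence in the norm implies
  uniform convergence on balls of the dual.\<close>

lemma FBL_norm_bounds_values:
  assumes "pos_homogeneous f"
  shows "ennreal \<bar>f \<phi>\<bar> \<le> ennreal (norm \<phi>) * FBL_norm f"
proof -
  define u where "u = (1 / norm \<phi>) *\<^sub>R \<phi>"
  have \<phi>: "\<phi> = norm \<phi> *\<^sub>R u" by (simp add: u_def)
  have "norm u \<le> 1" by (simp add: u_def)
  have "admissible [u]"
    unfolding admissible_def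
  proof
    fix x
    have "\<bar>blinfun_apply u x\<bar> \<le> 1 * norm x"
      using norm_blinfun[of u x] mult_right_mono[OF \<open>norm u \<le> 1\<close> norm_ge_zero, of x] by simp
    then show "(\<Sum>\<phi>\<leftarrow>[u]. ennreal \<bar>blinfun_apply \<phi> x\<bar>) \<le> ennreal (norm x)" by (simp add: ennreal_leI)
  qed
  from sum_le_FBL_norm[OF this, of f] have "ennreal \<bar>f u\<bar> \<le> FBL_norm f" by simp
  then have "ennreal (norm \<phi>) * ennreal \<bar>f u\<bar> \<le> ennreal (norm \<phi>) * FBL_norm f"
    by (intro mult_left_mono) auto
  also have "ennreal (norm \<phi>) * ennreal \<bar>f u\<bar> = ennreal \<bar>f (norm \<phi> *\<^sub>R u)\<bar>"
    using assms by (simp add: pos_homogeneous_def abs_mult ennreal_mult)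
  finally show ?thesis using \<phi> by simp
qed

lemma H1_cmult:
  assumes "f \<in> H1"
  shows "(\<lambda>\<phi>. c * f \<phi>) \<in> H1"
proof -
  have "FBL_norm (\<lambda>\<phi>. c * f \<phi>) < \<infinity>"
    by (rule le_less_trans[OF FBL_norm_cmult_le])
       (use assms in \<open>simp add: H1_def ennreal_mult_less_top\<close>)
  then show ?thesis using assms by (simp add: H1_def pos_homogeneous_def)
qed

lemma H1_closed:
  assumes "f \<in> H1" "g \<in> H1"
  shows "f + g \<in> H1" "sup f g \<in> H1" "inf f g \<in> H1"
proof -
  have hom: "pos_homogeneous f" "pos_homogeneous g" and fin: "FBL_norm f + FBL_norm g < \<infinity>"
    using assms by (auto simp: H1_def)
  have "FBL_norm (f + g) < \<infinity>" "FBL_norm (sup f g) < \<infinity>" "FBL_norm (inf f g) < \<infinity>"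
    by (rule le_less_trans[OF FBL_norm_add_le[of _ f g] fin]; simp add: sup_max inf_min max_def min_def)+
  then show "f + g \<in> H1" "sup f g \<in> H1" "inf f g \<in> H1"
    using hom by (auto simp: H1_def pos_homogeneous_def distrib_left sup_real_def inf_real_def
        max_mult_distrib_left min_mult_distrib_left)
qed

lemma evaluation_in_H1: "evaluation x \<in> H1"
proof -
  have "FBL_norm (evaluation x) \<le> ennreal (\<Sum>i\<in>{()}. norm x)"
    by (rule FBL_norm_le_sum_norms) (simp add: evaluation_def)
  then have "FBL_norm (evaluation x) < \<infinity>"
    by (simp add: le_less_trans)
  then show ?thesis
    by (simp add: H1_def pos_homogeneous_def evaluation_def blinfun.scaleR_left)
qed

lemma zero_in_H1: "(0 :: ('a::banach \<Rightarrow>\<^sub>L real) \<Rightarrow> real) \<in> H1"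
  using evaluation_in_H1[of "0::'a"] by (simp add: evaluation_def zero_fun_def)

lemma FBL_least: "closed_sublattice S \<Longrightarrow> range evaluation \<subseteq> S \<Longrightarrow> FBL \<subseteq> S"
  by (auto simp: FBL_def)

lemma in_FBL_I:
  assumes "f \<in> H1" "\<And>S. closed_sublattice S \<Longrightarrow> FBL \<subseteq> S \<Longrightarrow> f \<in> S"
  shows "f \<in> FBL"
proof -
  have "f \<in> S" if "closed_sublattice S" "range evaluation \<subseteq> S" for S
    using that FBL_least by (intro assms(2))
  then show ?thesis using assms(1) by (simp add: FBL_def)
qed

lemma zero_in_FBL: "0 \<in> FBL"
  using zero_in_H1 by (intro in_FBL_I) (simp_all add: closed_sublattice_def)

lemma FBL_closed:
  assumes "f \<in> FBL" "g \<in> FBL"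
  shows "f + g \<in> FBL" "sup f g \<in> FBL" "inf f g \<in> FBL"
proof -
  have "f \<in> H1" "g \<in> H1" using assms by (simp_all add: FBL_def)
  note closed = H1_closed[OF this]
  show "f + g \<in> FBL" "sup f g \<in> FBL" "inf f g \<in> FBL"
    by (intro in_FBL_I closed; use assms in \<open>simp add: closed_sublattice_def subset_iff\<close>)+
qed

lemma FBL_cmult:
  assumes "f \<in> FBL"
  shows "(\<lambda>\<phi>. c * f \<phi>) \<in> FBL"
proof (rule in_FBL_I)
  show "(\<lambda>\<phi>. c * f \<phi>) \<in> H1" using assms by (intro H1_cmult) (simp add: FBL_def)
qed (use assms in \<open>simp add: closed_sublattice_def subset_iff\<close>)

lemma evaluation_in_FBL: "evaluation x \<in> FBL"
  using evaluation_in_H1 by (auto simp: FBL_def)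

abbreviation weak_star_cball :: "real \<Rightarrow> ('a::real_normed_vector \<Rightarrow>\<^sub>L real) topology" where
  "weak_star_cball R \<equiv> subtopology strong_operator_topology (cball 0 R)"

text \<open>On a dual space the strong operator topology is the topology of pointwise convergence, that is, the
  weak-star topology.  Evaluations are continuous for it, lattice operations preserve continuity, and a limit
  in norm is a uniform limit on each ball; so the functions that are continuous on balls form a closed
  sublattice.  Continuity on all of the dual would not survive the passage to limits.\<close>

lemma FBL_weak_star_continuous_on_balls:
  assumes "f \<in> FBL"
  shows "continuous_map (weak_star_cball R) euclideanreal f"
proof -
  define S where "S = {f :: ('a \<Rightarrow>\<^sub>L real) \<Rightarrow> real. f \<in> H1 \<and> continuous_map (weak_star_cball R) euclideanreal f}"
  have ball: "topspace (weak_star_cball R) = cball (0 :: 'a \<Rightarrow>\<^sub>L real) R"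
    by (simp add: strong_operator_topology_topspace)
  have lim: "f \<in> S" if f: "f \<in> H1" and approx: "\<And>\<epsilon>. \<epsilon> > 0 \<Longrightarrow> \<exists>g\<in>S. FBL_norm (f - g) < \<epsilon>"
    for f :: "('a \<Rightarrow>\<^sub>L real) \<Rightarrow> real"
  proof -
    \<comment> \<open>A positive upper bound for the radius, which itself may be zero or negative.\<close>
    define R' where "R' = max R 1"
    have R': "R' > 0" "R \<le> R'" by (auto simp: R'_def)
    have "\<exists>g. g \<in> S \<and> FBL_norm (f - g) < ennreal (1 / Suc n)" for n
      using approx[of "ennreal (1 / Suc n)"] by auto
    then obtain g where g: "\<And>n. g n \<in> S" "\<And>n. FBL_norm (f - g n) < ennreal (1 / Suc n)" by metis
    have close: "\<bar>g n \<phi> - f \<phi>\<bar> \<le> R' * (1 / Suc n)" if "\<phi> \<in> cball 0 R" for n \<phi>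
    proof -
      have hom: "pos_homogeneous (f - g n)"
        using f g(1)[of n] by (auto simp: S_def H1_def pos_homogeneous_def algebra_simps)
      have "ennreal \<bar>(f - g n) \<phi>\<bar> \<le> ennreal (norm \<phi>) * FBL_norm (f - g n)"
        by (rule FBL_norm_bounds_values[OF hom])
      also have "\<dots> \<le> ennreal R' * ennreal (1 / Suc n)"
        using that R' g(2)[of n] by (intro mult_mono ennreal_leI) (auto intro: less_imp_le)
      also have "\<dots> = ennreal (R' * (1 / Suc n))" using R' by (intro ennreal_mult[symmetric]) auto
      finally show ?thesis using R' by (simp add: abs_minus_commute)
    qed
    have "continuous_map (weak_star_cball R) Met_TC.mtopology f"
    proof (rule Met_TC.continuous_map_uniform_limit_alt[where F = sequentially and f = g])
      show "\<forall>\<^sub>F n in sequentially. continuous_map (weak_star_cball R) Met_TC.mtopology (g n)"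
        using g(1) by (simp add: S_def)
      fix \<epsilon> :: real assume "\<epsilon> > 0"
      have "(\<lambda>n. R' * (1 / Suc n)) \<longlonglongrightarrow> R' * 0"
        using lim_1_over_n[THEN LIMSEQ_Suc] by (intro tendsto_intros) simp
      then have "\<forall>\<^sub>F n in sequentially. R' * (1 / Suc n) < \<epsilon>"
        using \<open>\<epsilon> > 0\<close> by (intro order_tendstoD) auto
      then show "\<forall>\<^sub>F n in sequentially. \<forall>\<phi>\<in>topspace (weak_star_cball R). dist (g n \<phi>) (f \<phi>) < \<epsilon>"
      proof eventually_elim
        case (elim n)
        show ?case
        proof
          fix \<phi> :: "'a \<Rightarrow>\<^sub>L real" assume "\<phi> \<in> topspace (weak_star_cball R)"
          then have "\<bar>g n \<phi> - f \<phi>\<bar> \<le> R' * (1 / Suc n)" unfolding ball by (rule close)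
          then show "dist (g n \<phi>) (f \<phi>) < \<epsilon>" using elim by (simp add: dist_real_def)
        qed
      qed
    qed auto
    then show ?thesis using f by (simp add: S_def)
  qed
  have "closed_sublattice S"
    unfolding closed_sublattice_def
  proof (intro conjI ballI allI impI)
    show "0 \<in> S" using zero_in_H1 by (simp add: S_def zero_fun_def)
    fix f g assume "f \<in> S" "g \<in> S"
    then have fg: "f \<in> H1" "g \<in> H1" and cont: "continuous_map (weak_star_cball R) euclideanreal f"
      "continuous_map (weak_star_cball R) euclideanreal g"
      by (auto simp: S_def)
    show "f + g \<in> S" "sup f g \<in> S" "inf f g \<in> S"
      using H1_closed[OF fg] continuous_map_add[OF cont] continuous_map_real_max[OF cont]
        continuous_map_real_min[OF cont]
      by (simp_all add: S_def plus_fun_def sup_fun_def inf_fun_def sup_real_def inf_real_def)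
  next
    fix c f assume "f \<in> S"
    then show "(\<lambda>\<phi>. c * f \<phi>) \<in> S"
      using H1_cmult[of f] continuous_map_real_mult_left[of "weak_star_cball R" f c] by (simp add: S_def)
  qed (use lim in \<open>auto simp: S_def\<close>)
  moreover have "range evaluation \<subseteq> S"
    using evaluation_in_H1 strong_operator_topology_continuous_evaluation
    by (auto simp: S_def evaluation_def intro: continuous_map_from_subtopology)
  ultimately show ?thesis using FBL_least assms by (auto simp: S_def)
qed

lemma strong_operator_topology_contains_basis:
  assumes "openin strong_operator_topology U" "\<phi> \<in> U"
  obtains F \<delta> where "finite F" "\<delta> > 0" "\<And>\<psi>. (\<And>x. x \<in> F \<Longrightarrow> dist (blinfun_apply \<phi> x) (blinfun_apply \<psi> x) < \<delta>) \<Longrightarrow> \<psi> \<in> U"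
proof -
  obtain V where V: "open V" "U = blinfun_apply -` V"
    using assms(1) by (auto simp: strong_operator_topology_def openin_pullback_topology)
  then have "openin (product_topology (\<lambda>i. euclidean) UNIV) V" "blinfun_apply \<phi> \<in> V"
    using assms(2) by (auto simp: open_fun_def)
  from product_topology_open_contains_basis[OF this]
  obtain X where X: "blinfun_apply \<phi> \<in> (\<Pi>\<^sub>E i\<in>UNIV. X i)" "\<And>i. open (X i)" "finite {i. X i \<noteq> UNIV}"
    "(\<Pi>\<^sub>E i\<in>UNIV. X i) \<subseteq> V"
    by auto
  define F where "F = {i. X i \<noteq> UNIV}"
  have finF: "finite F" using X(3) by (simp add: F_def)
  have "\<exists>e>0. ball (blinfun_apply \<phi> x) e \<subseteq> X x" for x
  proof -
    have "blinfun_apply \<phi> x \<in> X x" using PiE_mem[OF X(1) UNIV_I] .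
    then show ?thesis using X(2)[of x] unfolding open_contains_ball by (rule bspec[rotated])
  qed
  then obtain e where e: "\<And>x. e x > 0" "\<And>x. ball (blinfun_apply \<phi> x) (e x) \<subseteq> X x" by metis
  define \<delta> where "\<delta> = Min (insert 1 (e ` F))"
  show thesis
  proof (rule that[OF finF])
    show "\<delta> > 0" using finF e(1) by (simp add: \<delta>_def)
    fix \<psi> assume close: "\<And>x. x \<in> F \<Longrightarrow> dist (blinfun_apply \<phi> x) (blinfun_apply \<psi> x) < \<delta>"
    have "blinfun_apply \<psi> x \<in> X x" for x
    proof (cases "x \<in> F")
      case True
      then have "\<delta> \<le> e x" using finF by (simp add: \<delta>_def)
      then have "blinfun_apply \<psi> x \<in> ball (blinfun_apply \<phi> x) (e x)" using close[OF True] by simp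
      then show ?thesis using e(2) by blast
    qed (simp add: F_def)
    then show "\<psi> \<in> U" using X(4) V(2) by (auto simp: PiE_def)
  qed
qed

lemma abs_evaluation_in_FBL: "(\<lambda>\<phi>. \<bar>blinfun_apply \<phi> x\<bar>) \<in> FBL"
proof -
  have "sup (evaluation x) (\<lambda>\<phi>. (-1) * evaluation x \<phi>) \<in> FBL"
    by (intro FBL_closed FBL_cmult evaluation_in_FBL)
  also have "sup (evaluation x) (\<lambda>\<phi>. (-1) * evaluation x \<phi>) = (\<lambda>\<phi>. \<bar>blinfun_apply \<phi> x\<bar>)"
    by (auto simp: evaluation_def sup_real_def)
  finally show ?thesis .
qed

lemma sum_in_FBL:
  assumes "finite I" "\<And>i. i \<in> I \<Longrightarrow> f i \<in> FBL"
  shows "(\<lambda>\<phi>. \<Sum>i\<in>I. f i \<phi>) \<in> FBL"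
  using assms
proof (induction I)
  case empty
  then show ?case using zero_in_FBL by (simp add: zero_fun_def)
next
  case (insert j I)
  then have "f j + (\<lambda>\<phi>. \<Sum>i\<in>I. f i \<phi>) \<in> FBL"
    by (intro FBL_closed) auto
  then show ?case using insert by (simp add: plus_fun_def)
qed

section \<open>Dyadic step functions in a copy of \<open>L\<^sub>1[0,1]\<close>\<close>

definition dyadic_indicator :: "nat \<Rightarrow> nat \<Rightarrow> real \<Rightarrow> real" where
  "dyadic_indicator m i = indicator {real i / 2^m ..< real (i + 1) / 2^m}"

lemma dyadic_indicator_eq:
  assumes "t \<ge> 0"
  shows "dyadic_indicator m i t = (if i = nat \<lfloor>2^m * t\<rfloor> then 1 else 0)"
proof -
  have "t \<in> {real i / 2^m ..< real (i + 1) / 2^m} \<longleftrightarrow> real i \<le> 2^m * t \<and> 2^m * t < real i + 1"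
    by (auto simp: field_simps)
  also have "\<dots> \<longleftrightarrow> \<lfloor>2^m * t\<rfloor> = int i" by (simp add: floor_eq_iff)
  also have "\<dots> \<longleftrightarrow> i = nat \<lfloor>2^m * t\<rfloor>" using assms by auto
  finally show ?thesis by (auto simp: dyadic_indicator_def)
qed

lemma dyadic_indicator_neg:
  assumes "t < 0"
  shows "dyadic_indicator m i t = 0"
proof -
  have "0 \<le> real i / 2^m" by simp
  then have "\<not> real i / 2^m \<le> t" using assms by linarith
  then show ?thesis by (simp add: dyadic_indicator_def)
qed

lemma dyadic_indicator_split:
  "dyadic_indicator m i t = dyadic_indicator (Suc m) (2 * i) t + dyadic_indicator (Suc m) (2 * i + 1) t"
proof -
  define p q r where "p = real i / 2^m" and "q = real (2 * i + 1) / 2^Suc m" and "r = real (i + 1) / 2^m"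
  have "p \<le> q" "q \<le> r" by (simp_all add: p_def q_def r_def field_simps)
  then have "indicator {p..<r} t = indicator {p..<q} t + (indicator {q..<r} t :: real)"
    by (auto simp: indicator_def)
  moreover have "real (2 * i) / 2^Suc m = p" "real (2 * i + 1 + 1) / 2^Suc m = r"
    by (simp_all add: p_def r_def field_simps)
  ultimately show ?thesis
    unfolding dyadic_indicator_def by (simp only: p_def[symmetric] q_def[symmetric] r_def[symmetric])
qed

lemma has_bochner_integral_dyadic_indicator:
  assumes "i < 2^m"
  shows "has_bochner_integral unit_leb (dyadic_indicator m i) (1 / 2^m)"
proof -
  let ?A = "{real i / 2^m ..< real (i + 1) / 2^m}"
  have "real (i + 1) \<le> real (2^m)" using assms by (simp only: of_nat_le_iff)
  then have "real (i + 1) \<le> 2^m" by simp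
  then have "0 \<le> real i / 2^m" "real (i + 1) / 2^m \<le> 1" by (simp_all add: divide_le_eq)
  then have "?A \<subseteq> {0..1}" by (intro subsetI) (simp only: atLeastLessThan_iff atLeastAtMost_iff, linarith)
  moreover have "emeasure lebesgue ?A = ennreal (1 / 2^m)"
    by (simp add: field_simps)
  ultimately have "emeasure unit_leb ?A = ennreal (1 / 2^m)" "?A \<in> sets unit_leb"
    by (simp_all add: emeasure_restrict_space sets_restrict_space_iff)
  then show ?thesis
    unfolding dyadic_indicator_def
    using has_bochner_integral_real_indicator[of ?A unit_leb] by (simp add: measure_def)
qed

lemma sum_scaleR_abs_L1_unit:
  assumes "finite I" "\<And>i. i \<in> I \<Longrightarrow> integrable unit_leb (f i)"
  shows "(\<Sum>i\<in>I. a i *\<^sub>R abs_L1_unit (f i)) = abs_L1_unit (\<lambda>t. \<Sum>i\<in>I. a i * f i t)"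
  using assms
proof (induction I)
  case empty then show ?case by (simp add: zero_L1_unit_def)
next
  case (insert j I)
  then have "integrable unit_leb (\<lambda>t. \<Sum>i\<in>I. a i * f i t)" "integrable unit_leb (f j)" by auto
  then show ?case using insert
    by (simp add: plus_L1_unit.abs_eq scaleR_L1_unit.abs_eq)
qed

lemma norm_abs_L1_unit:
  "integrable unit_leb f \<Longrightarrow> norm (abs_L1_unit f) = (\<integral>t. \<bar>f t\<bar> \<partial>unit_leb)"
  by (simp add: norm_L1_unit.abs_eq)

definition dyadic_step :: "nat \<Rightarrow> nat \<Rightarrow> L1_unit" where
  "dyadic_step m i = abs_L1_unit (dyadic_indicator m i)"

lemma dyadic_step_split:
  assumes "i < 2^m"
  shows "dyadic_step m i = dyadic_step (Suc m) (2 * i) + dyadic_step (Suc m) (2 * i + 1)"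
proof -
  have "integrable unit_leb (dyadic_indicator (Suc m) (2 * i))"
    "integrable unit_leb (dyadic_indicator (Suc m) (2 * i + 1))"
    using assms by (auto intro!: has_bochner_integral_dyadic_indicator[THEN integrable.intros])
  then show ?thesis
    unfolding dyadic_step_def dyadic_indicator_split[of m i, abs_def]
    by (simp add: plus_L1_unit.abs_eq)
qed

text \<open>The dyadic intervals of one level are disjoint and have length \<open>1 / 2^m\<close>, so the absolute value can be
  taken inside the sum pointwise.\<close>

lemma norm_sum_dyadic_step:
  "norm (\<Sum>i<2^m. a i *\<^sub>R dyadic_step m i) = (\<Sum>i<2^m. \<bar>a i\<bar>) / 2^m"
proof -
  have int: "integrable unit_leb (dyadic_indicator m i)" if "i < 2^m" for i
    using that by (rule has_bochner_integral_dyadic_indicator[THEN integrable.intros])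
  have pt: "\<bar>\<Sum>i<2^m. a i * dyadic_indicator m i t\<bar> = (\<Sum>i<2^m. \<bar>a i\<bar> * dyadic_indicator m i t)" for t
    by (cases "t \<ge> 0") (simp_all add: dyadic_indicator_eq dyadic_indicator_neg if_distrib cong: if_cong)
  have "norm (\<Sum>i<2^m. a i *\<^sub>R dyadic_step m i) = (\<integral>t. \<bar>\<Sum>i<2^m. a i * dyadic_indicator m i t\<bar> \<partial>unit_leb)"
    unfolding dyadic_step_def
    by (subst sum_scaleR_abs_L1_unit, simp, simp add: int, rule norm_abs_L1_unit)
       (intro Bochner_Integration.integrable_sum integrable_mult_right int, simp)
  also have "\<dots> = (\<Sum>i<2^m. \<bar>a i\<bar> * (\<integral>t. dyadic_indicator m i t \<partial>unit_leb))"
    unfolding pt using int by (subst Bochner_Integration.integral_sum) auto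
  also have "\<dots> = (\<Sum>i<2^m. \<bar>a i\<bar> * (1 / 2^m))"
    by (intro sum.cong refl)
       (simp add: has_bochner_integral_dyadic_indicator[THEN has_bochner_integral_integral_eq])
  finally show ?thesis by (simp add: sum_divide_distrib)
qed

lemma continuous_homogeneous_bounded_on_subspace:
  fixes S :: "'a::real_normed_vector \<Rightarrow> 'b::real_normed_vector"
  assumes F: "subspace F" and cont: "continuous_on F S"
    and hom: "\<And>c x. x \<in> F \<Longrightarrow> S (c *\<^sub>R x) = c *\<^sub>R S x"
  obtains K where "K > 0" "\<And>x. x \<in> F \<Longrightarrow> norm (S x) \<le> K * norm x"
proof -
  have 0: "0 \<in> F" "S 0 = 0" using subspace_0[OF F] hom[of 0 0] by auto
  obtain \<delta> where \<delta>: "\<delta> > 0" "\<And>x. x \<in> F \<Longrightarrow> dist x 0 \<le> \<delta> \<Longrightarrow> dist (S x) (S 0) < 1"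
    using continuous_onE[OF cont 0(1) zero_less_one] by blast
  show thesis
  proof (rule that)
    show "2 / \<delta> > 0" using \<delta> by simp
    fix x assume x: "x \<in> F"
    show "norm (S x) \<le> 2 / \<delta> * norm x"
    proof (cases "x = 0")
      case False
      define c where "c = \<delta> / (2 * norm x)"
      have c: "c > 0" "norm (c *\<^sub>R x) \<le> \<delta>" using False \<delta>(1) by (auto simp: c_def)
      have "norm (S (c *\<^sub>R x)) < 1"
        using \<delta>(2)[OF subspace_scale[OF F x]] c 0 by simp
      then have "c * norm (S x) < 1" using hom[OF x] c by simp
      then show ?thesis using False \<delta>(1) by (simp add: c_def field_simps)
    qed (simp add: 0)
  qed
qed

text \<open>All that the argument uses of a copy of the space of integrable functions: \<open>y m i\<close> is the image of the
  indicator function of the \<open>i\<close>-th dyadic interval of length \<open>1 / 2^m\<close>.  The constants bound the norms of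
  the embedding and of its inverse.\<close>

locale L1_tree =
  fixes y :: "nat \<Rightarrow> nat \<Rightarrow> 'a::banach" and C K :: real
  assumes C_pos: "C > 0" and K_pos: "K > 0"
    and split: "\<And>m i. i < 2^m \<Longrightarrow> y m i = y (Suc m) (2 * i) + y (Suc m) (2 * i + 1)"
    and upper: "\<And>m i. i < 2^m \<Longrightarrow> norm (y m i) \<le> C / 2^m"
    and lower: "\<And>m a. (\<Sum>i<2^m. \<bar>a i\<bar>) / 2^m \<le> K * norm (\<Sum>i<2^m. a i *\<^sub>R y m i)"

lemma L1_tree_in_isomorphic_copy:
  fixes F :: "'a::banach set"
  assumes "isomorphic_subspace TYPE(L1_unit) F"
  obtains y :: "nat \<Rightarrow> nat \<Rightarrow> 'a" and C K where "L1_tree y C K"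
proof -
  from assms obtain T :: "L1_unit \<Rightarrow> 'a" and S where F: "subspace F" and lin: "linear T"
    and hom: "homeomorphism UNIV F T S"
    by (auto simp: isomorphic_subspace_def)
  from hom have cT: "continuous_on UNIV T" and cS: "continuous_on F S" and ST: "\<And>x. S (T x) = x"
    and TS: "\<And>x. x \<in> F \<Longrightarrow> T (S x) = x" and TF: "\<And>x. T x \<in> F"
    by (auto simp: homeomorphism_def)
  interpret T: linear T by (rule lin)
  obtain C where C: "C > 0" "\<And>x. norm (T x) \<le> C * norm x"
    using continuous_homogeneous_bounded_on_subspace[OF subspace_UNIV cT] T.scaleR by auto
  have "S (c *\<^sub>R x) = c *\<^sub>R S x" if "x \<in> F" for c x
    using ST[of "c *\<^sub>R S x"] TS[OF that] by (simp add: T.scaleR)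
  then obtain K where K: "K > 0" "\<And>x. x \<in> F \<Longrightarrow> norm (S x) \<le> K * norm x"
    using continuous_homogeneous_bounded_on_subspace[OF F cS] by blast
  have "L1_tree (\<lambda>m i. T (dyadic_step m i)) C K"
  proof
    show "C > 0" "K > 0" by fact+
    show "T (dyadic_step m i) = T (dyadic_step (Suc m) (2 * i)) + T (dyadic_step (Suc m) (2 * i + 1))"
      if "i < 2^m" for m i
      using dyadic_step_split[OF that] by (simp add: T.add)
    show "norm (T (dyadic_step m i)) \<le> C / 2^m" if "i < 2^m" for m i
    proof -
      have "norm (dyadic_step m i) = 1 / 2^m"
        using norm_sum_dyadic_step[where a = "\<lambda>j. if j = i then 1 else 0" and m = m] that
        by (simp add: if_distrib[of "\<lambda>r. r *\<^sub>R _"] if_distrib[of abs] cong: if_cong)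
      then show ?thesis using C(2)[of "dyadic_step m i"] by simp
    qed
    fix m and a :: "nat \<Rightarrow> real"
    let ?x = "\<Sum>i<2^m. a i *\<^sub>R dyadic_step m i"
    have "(\<Sum>i<2^m. \<bar>a i\<bar>) / 2^m = norm (S (T ?x))" by (simp add: ST norm_sum_dyadic_step)
    also have "\<dots> \<le> K * norm (T ?x)" by (intro K(2) TF)
    finally show "(\<Sum>i<2^m. \<bar>a i\<bar>) / 2^m \<le> K * norm (\<Sum>i<2^m. a i *\<^sub>R T (dyadic_step m i))"
      by (simp add: T.sum T.scaleR)
  qed
  then show thesis by (rule that)
qed

section \<open>Level sums of a dyadic tree\<close>

lemma sum_lessThan_double:
  fixes f :: "nat \<Rightarrow> 'b::comm_monoid_add"
  shows "(\<Sum>i<2 * n. f i) = (\<Sum>i<n. f (2 * i) + f (2 * i + 1))"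
  by (induction n) (simp_all add: add.assoc)

context L1_tree
begin

text \<open>On \<open>\<phi>\<close> composed with the embedding, which is given by a bounded function \<open>g\<close> on the unit interval, these sums
  increase to the integral of \<open>\<bar>g\<bar>\<close>.\<close>

definition level_sum :: "nat \<Rightarrow> ('a \<Rightarrow>\<^sub>L real) \<Rightarrow> real" where
  "level_sum m \<phi> = (\<Sum>i<2^m. \<bar>blinfun_apply \<phi> (y m i)\<bar>)"

lemma level_sum_nonneg: "level_sum m \<phi> \<ge> 0"
  by (simp add: level_sum_def sum_nonneg)

lemma level_sum_in_FBL: "level_sum m \<in> FBL"
  unfolding level_sum_def[abs_def] by (intro sum_in_FBL abs_evaluation_in_FBL) simp

lemma level_sum_mono: "m \<le> n \<Longrightarrow> level_sum m \<phi> \<le> level_sum n \<phi>"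
proof (induction rule: dec_induct)
  case (step n)
  have "level_sum n \<phi> \<le> (\<Sum>i<2^n. \<bar>blinfun_apply \<phi> (y (Suc n) (2 * i))\<bar> + \<bar>blinfun_apply \<phi> (y (Suc n) (2 * i + 1))\<bar>)"
    unfolding level_sum_def
  proof (rule sum_mono)
    fix i :: nat assume "i \<in> {..<2^n}"
    then have "blinfun_apply \<phi> (y n i) = blinfun_apply \<phi> (y (Suc n) (2 * i)) + blinfun_apply \<phi> (y (Suc n) (2 * i + 1))"
      using split[of i n] by (simp add: blinfun.add_right)
    then show "\<bar>blinfun_apply \<phi> (y n i)\<bar> \<le>
        \<bar>blinfun_apply \<phi> (y (Suc n) (2 * i))\<bar> + \<bar>blinfun_apply \<phi> (y (Suc n) (2 * i + 1))\<bar>"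
      by (simp only: abs_triangle_ineq)
  qed
  also have "\<dots> = level_sum (Suc n) \<phi>" by (simp add: level_sum_def sum_lessThan_double)
  finally show ?case using step by simp
qed simp

lemma sum_norms_le: "(\<Sum>i<2^m. norm (y m i)) \<le> C"
  using sum_bounded_above[of "{..<2^m}" "\<lambda>i. norm (y m i)" "C / 2^m"] upper by simp

lemma level_sum_le: "level_sum m \<phi> \<le> C * norm \<phi>"
proof -
  have "level_sum m \<phi> \<le> (\<Sum>i<2^m. norm \<phi> * norm (y m i))"
    unfolding level_sum_def using norm_blinfun[of \<phi>] by (intro sum_mono) simp
  also have "\<dots> \<le> norm \<phi> * C"
    using sum_norms_le by (simp add: sum_distrib_left[symmetric] mult_left_mono)
  finally show ?thesis by (simp add: mult.commute)
qed

lemma FBL_norm_inf_level_sum_le: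
  assumes "\<And>\<phi>. b \<phi> \<ge> 0"
  shows "FBL_norm (inf b (level_sum m)) \<le> ennreal C"
proof -
  have "FBL_norm (inf b (level_sum m)) \<le> ennreal (\<Sum>i<2^m. norm (y m i))"
  proof (rule FBL_norm_le_sum_norms)
    fix \<phi>
    have "\<bar>inf b (level_sum m) \<phi>\<bar> \<le> level_sum m \<phi>"
      using assms[of \<phi>] level_sum_nonneg[of m \<phi>] by (simp add: inf_real_def)
    then show "\<bar>inf b (level_sum m) \<phi>\<bar> \<le> (\<Sum>i<2^m. \<bar>blinfun_apply \<phi> (y m i)\<bar>)"
      by (simp only: level_sum_def)
  qed
  also have "\<dots> \<le> ennreal C" by (intro ennreal_leI sum_norms_le)
  finally show ?thesis .
qed

section \<open>Oscillating functionals\<close>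

text \<open>Prescribing the values \<open>c i / 2^m\<close> means extending to the whole space the functional given by integration
  against the step function with values \<open>c i\<close>.  Its norm is controlled by the sup norm of that function alone,
  whatever the level.\<close>

lemma functional_on_level:
  assumes "\<And>i. \<bar>c i\<bar> \<le> 1"
  obtains \<phi> :: "'a \<Rightarrow>\<^sub>L real" where "norm \<phi> \<le> K" "\<And>i. i < 2^m \<Longrightarrow> blinfun_apply \<phi> (y m i) = c i / 2^m"
proof -
  have "(\<Sum>i<2^m. a i * (c i / 2^m)) \<le> K * norm (\<Sum>i<2^m. a i *\<^sub>R y m i)" for a
  proof -
    have "a i * c i \<le> \<bar>a i\<bar>" for i
      using mult_left_mono[OF assms[of i] abs_ge_zero[of "a i"]] abs_ge_self[of "a i * c i"]
      by (simp add: abs_mult)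
    then have "(\<Sum>i<2^m. a i * c i) / 2^m \<le> (\<Sum>i<2^m. \<bar>a i\<bar>) / 2^m"
      by (intro divide_right_mono sum_mono) auto
    then show ?thesis using lower[of a m] by (simp add: sum_divide_distrib)
  qed
  then show thesis
    using functional_with_prescribed_values[of "{..<2^m}" K "\<lambda>i. c i / 2^m" "y m"] K_pos that by auto
qed

text \<open>For signs \<open>s\<close> and \<open>t\<close> one has \<open>\<bar>s - t\<bar> = 1 - s * t\<close>, so orthogonality of two rows evaluates the sum.\<close>

lemma level_sum_hadamard_difference:
  assumes W: "\<And>k i. W k i \<in> {1, -1::real}" and orth: "(\<Sum>i<2^m. W k i * W l i) = 0"
    and "\<And>i. i < 2^m \<Longrightarrow> blinfun_apply \<phi> (y m i) = W k i / 2^m"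
    and "\<And>i. i < 2^m \<Longrightarrow> blinfun_apply \<psi> (y m i) = W l i / 2^m"
  shows "level_sum m (\<phi> - \<psi>) = 1"
proof -
  have "\<bar>W k i / 2^m - W l i / 2^m\<bar> = (1 - W k i * W l i) / 2^m" for i
    using W[of k i] W[of l i] by auto
  then have "level_sum m (\<phi> - \<psi>) = (\<Sum>i<2^m. (1 - W k i * W l i) / 2^m)"
    using assms(3,4) by (simp add: level_sum_def blinfun.diff_left)
  also have "\<dots> = 1" using orth by (simp add: sum_divide_distrib[symmetric] sum_subtractf)
  finally show ?thesis .
qed

text \<open>The heart of the matter: in every weak-star neighbourhood of \<open>0\<close> there are functionals that are
  bounded by a fixed constant, yet have a level sum equal to \<open>1\<close>.  Individual extensions of the Rademacher
  functionals need not be small on \<open>F\<close>, because they are not under control outside the copy of \<open>L\<^sub>1\<close>.  But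
  sufficiently many of them contain two that nearly agree on \<open>F\<close>, and the difference of these two works.\<close>

lemma small_oscillating_functional:
  assumes "finite F" "\<delta> > 0"
  shows "\<exists>\<omega> m. norm \<omega> \<le> 2 * K \<and> level_sum m \<omega> = 1 \<and> (\<forall>x\<in>F. \<bar>blinfun_apply \<omega> x\<bar> < \<delta>)"
proof -
  obtain N where N: "\<And>z :: nat \<Rightarrow> 'a \<Rightarrow> real.
      (\<And>k x. k < N \<Longrightarrow> x \<in> F \<Longrightarrow> \<bar>z k x\<bar> \<le> K * (\<Sum>x\<in>F. norm x)) \<Longrightarrow>
       \<exists>k<N. \<exists>l<N. k \<noteq> l \<and> (\<forall>x\<in>F. \<bar>z k x - z l x\<bar> < \<delta>)"
    using pigeonhole_close_pair[OF assms, of "K * (\<Sum>x\<in>F. norm x)"] by blast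
  obtain W :: "nat \<Rightarrow> nat \<Rightarrow> real" where W: "\<And>k i. W k i \<in> {1, -1}"
    and orth: "\<And>k l. k < 2^N \<Longrightarrow> l < 2^N \<Longrightarrow> k \<noteq> l \<Longrightarrow> (\<Sum>i<2^N. W k i * W l i) = 0"
    using hadamard_matrix_exists[of N] by blast
  have "\<bar>W k i\<bar> \<le> 1" for k i using W[of k i] by auto
  then have "\<exists>\<phi> :: 'a \<Rightarrow>\<^sub>L real. norm \<phi> \<le> K \<and> (\<forall>i<2^N. blinfun_apply \<phi> (y N i) = W k i / 2^N)" for k
    using functional_on_level[of "W k" N] by metis
  then obtain z :: "nat \<Rightarrow> 'a \<Rightarrow>\<^sub>L real" where z: "\<And>k. norm (z k) \<le> K"
    and zW: "\<And>k i. i < 2^N \<Longrightarrow> blinfun_apply (z k) (y N i) = W k i / 2^N" by metis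
  have "\<bar>blinfun_apply (z k) x\<bar> \<le> K * (\<Sum>x\<in>F. norm x)" if "x \<in> F" for k x
  proof -
    have "\<bar>blinfun_apply (z k) x\<bar> \<le> K * norm x"
      using norm_blinfun[of "z k" x] mult_right_mono[OF z[of k] norm_ge_zero[of x]] by simp
    also have "\<dots> \<le> K * (\<Sum>x\<in>F. norm x)"
      using that assms K_pos by (intro mult_left_mono member_le_sum) auto
    finally show ?thesis .
  qed
  then obtain k l where kl: "k < N" "l < N" "k \<noteq> l"
    and close: "\<And>x. x \<in> F \<Longrightarrow> \<bar>blinfun_apply (z k) x - blinfun_apply (z l) x\<bar> < \<delta>"
    using N[of "\<lambda>k. blinfun_apply (z k)"] by blast
  \<comment> \<open>The level is the number of rows wanted; its Hadamard matrix has more rows than that.\<close>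
  have "k < 2^N" "l < 2^N" using kl less_exp[of N] by linarith+
  show ?thesis
  proof (intro exI conjI ballI)
    show "norm (z k - z l) \<le> 2 * K" using norm_triangle_ineq4[of "z k" "z l"] z[of k] z[of l] by simp
    show "level_sum N (z k - z l) = 1"
      by (rule level_sum_hadamard_difference[OF W orth[OF \<open>k < 2^N\<close> \<open>l < 2^N\<close> kl(3)] zW zW])
    show "\<bar>blinfun_apply (z k - z l) x\<bar> < \<delta>" if "x \<in> F" for x
      using close[OF that] by (simp add: blinfun.diff_left)
  qed
qed

text \<open>A large multiple of an oscillating functional is added to \<open>\<phi>\<close>.  The factor depends on \<open>B\<close> and \<open>\<phi>\<close> only,
  not on the neighbourhood, so all the perturbed functionals stay in one ball, where elements of the free
  Banach lattice are continuous.\<close>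

lemma level_sum_unbounded_nearby:
  obtains R where "\<phi> \<in> weak_star_cball R closure_of {\<psi>. \<exists>m. B \<le> level_sum m \<psi>}"
proof -
  define M where "M = 1 + \<bar>B\<bar> + C * norm \<phi>"
  have M: "M > 0" using C_pos by (simp add: M_def add_pos_nonneg)
  define R where "R = norm \<phi> + M * (2 * K)"
  have R: "norm \<phi> \<le> R" using M K_pos by (simp add: R_def)
  have "\<exists>\<psi>. (\<exists>m. B \<le> level_sum m \<psi>) \<and> \<psi> \<in> T" if T: "\<phi> \<in> T" "openin (weak_star_cball R) T" for T
  proof -
    from T(2) obtain U where U: "openin strong_operator_topology U" "T = U \<inter> cball 0 R"
      by (auto simp: openin_subtopology)
    with T(1) have "\<phi> \<in> U" by blast
    obtain F \<delta> where F: "finite F" "\<delta> > 0"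
      and inU: "\<And>\<psi>. (\<And>x. x \<in> F \<Longrightarrow> dist (blinfun_apply \<phi> x) (blinfun_apply \<psi> x) < \<delta>) \<Longrightarrow> \<psi> \<in> U"
      using strong_operator_topology_contains_basis[OF U(1) \<open>\<phi> \<in> U\<close>] by blast
    have "\<delta> / M > 0" using F M by simp
    obtain \<omega> m where \<omega>: "norm \<omega> \<le> 2 * K" "level_sum m \<omega> = 1"
      "\<And>x. x \<in> F \<Longrightarrow> \<bar>blinfun_apply \<omega> x\<bar> < \<delta> / M"
      using small_oscillating_functional[OF F(1) \<open>\<delta> / M > 0\<close>] by blast
    define \<psi> where "\<psi> = \<phi> + M *\<^sub>R \<omega>"
    have "\<psi> \<in> U"
      using \<omega>(3) M by (intro inU) (simp add: \<psi>_def blinfun.add_left blinfun.scaleR_left dist_real_def abs_mult field_simps)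
    moreover have "norm \<psi> \<le> R"
    proof -
      have "norm \<psi> \<le> norm \<phi> + M * norm \<omega>"
        using norm_triangle_ineq[of \<phi> "M *\<^sub>R \<omega>"] M by (simp add: \<psi>_def)
      also have "\<dots> \<le> R"
        unfolding R_def using \<omega>(1) M by (intro add_left_mono mult_left_mono) auto
      finally show ?thesis .
    qed
    moreover have "B \<le> level_sum m \<psi>"
    proof -
      have "M * level_sum m \<omega> \<le> level_sum m \<psi> + level_sum m \<phi>"
        unfolding level_sum_def sum_distrib_left sum.distrib[symmetric]
      proof (rule sum_mono)
        fix i
        have "M * \<bar>blinfun_apply \<omega> (y m i)\<bar> = \<bar>blinfun_apply \<psi> (y m i) - blinfun_apply \<phi> (y m i)\<bar>"
          using M by (simp add: \<psi>_def blinfun.add_left blinfun.scaleR_left abs_mult)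
        then show "M * \<bar>blinfun_apply \<omega> (y m i)\<bar> \<le> \<bar>blinfun_apply \<psi> (y m i)\<bar> + \<bar>blinfun_apply \<phi> (y m i)\<bar>"
          by simp
      qed
      then show ?thesis using \<omega>(2) level_sum_le[of m \<phi>] by (simp add: M_def)
    qed
    ultimately show ?thesis using U(2) by auto
  qed
  then have "\<phi> \<in> weak_star_cball R closure_of {\<psi>. \<exists>m. B \<le> level_sum m \<psi>}"
    using R by (auto simp: in_closure_of strong_operator_topology_topspace)
  then show thesis by (rule that)
qed

section \<open>Failure of the Fatou property\<close>

text \<open>The supremum in the free Banach lattice can exceed the pointwise one.  An upper bound \<open>c\<close> dominates
  \<open>b\<close> wherever some level sum is large, functionals of this kind accumulate at every \<open>\<phi>\<close> within a ball, and
  both \<open>b\<close> and \<open>c\<close> are weak-star continuous there.\<close>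

lemma is_sup_in_FBL_inf_level_sum:
  assumes "b \<in> FBL"
  shows "is_sup_in FBL (range (\<lambda>m. inf b (level_sum m))) b"
  unfolding is_sup_in_def
proof (intro conjI ballI impI)
  fix c assume c: "c \<in> FBL" "\<forall>a\<in>range (\<lambda>m. inf b (level_sum m)). a \<le> c"
  show "b \<le> c"
  proof (rule le_funI)
    fix \<phi> :: "'a \<Rightarrow>\<^sub>L real"
    obtain R where R: "\<phi> \<in> weak_star_cball R closure_of {\<psi>. \<exists>m. b \<phi> \<le> level_sum m \<psi>}"
      by (rule level_sum_unbounded_nearby)
    \<comment> \<open>The constant \<open>b \<phi>\<close> caps \<open>b\<close> so that the inequality passes to the limit as a closed condition.\<close>
    have "min (b \<phi>) (b \<phi>) \<le> c \<phi>"
    proof (rule forall_in_closure_of[OF R, where P = "\<lambda>\<psi>. min (b \<psi>) (b \<phi>) \<le> c \<psi>"])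
      fix \<psi> assume "\<psi> \<in> {\<psi>. \<exists>m. b \<phi> \<le> level_sum m \<psi>}"
      then obtain m where m: "b \<phi> \<le> level_sum m \<psi>" by blast
      have "inf b (level_sum m) \<psi> \<le> c \<psi>" using c(2) by (auto simp: le_fun_def)
      then show "min (b \<psi>) (b \<phi>) \<le> c \<psi>" using m by (auto simp: inf_real_def min_def split: if_splits)
    next
      have "continuous_map (weak_star_cball R) euclideanreal (\<lambda>\<psi>. c \<psi> - min (b \<psi>) (b \<phi>))"
        using FBL_weak_star_continuous_on_balls[OF assms, of R] FBL_weak_star_continuous_on_balls[OF c(1), of R]
        by (intro continuous_map_diff continuous_map_real_min) auto
      from closedin_continuous_map_preimage[OF this, of "{0..}"]
      show "closedin (weak_star_cball R) {\<psi> \<in> topspace (weak_star_cball R). min (b \<psi>) (b \<phi>) \<le> c \<psi>}"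
        by simp
    qed
    then show "b \<phi> \<le> c \<phi>" by simp
  qed
qed (use assms in auto)

lemma directed_up_inf_level_sum: "directed_up (range (\<lambda>m. inf b (level_sum m)))"
proof -
  have mono: "inf b (level_sum m) \<le> inf b (level_sum n)" if "m \<le> n" for m n
    using level_sum_mono[OF that] by (intro inf_mono) (auto simp: le_fun_def)
  show ?thesis
    unfolding directed_up_def
  proof (intro conjI ballI)
    fix f g assume "f \<in> range (\<lambda>m. inf b (level_sum m))" "g \<in> range (\<lambda>m. inf b (level_sum m))"
    then obtain m n where "f = inf b (level_sum m)" "g = inf b (level_sum n)" by blast
    then show "\<exists>h\<in>range (\<lambda>m. inf b (level_sum m)). f \<le> h \<and> g \<le> h"
      using mono[of m "max m n"] mono[of n "max m n"] by auto
  qed auto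
qed

lemma not_Fatou: "\<not> Fatou_property l (FBL :: (('a \<Rightarrow>\<^sub>L real) \<Rightarrow> real) set) FBL_norm"
proof
  assume Fatou: "Fatou_property l (FBL :: (('a \<Rightarrow>\<^sub>L real) \<Rightarrow> real) set) FBL_norm"
  \<comment> \<open>The maximum with \<open>0\<close> mirrors \<open>ennreal l\<close>, which vanishes for negative \<open>l\<close>.\<close>
  define r where "r = K * (max l 0 * C) + 1"
  have "0 \<le> K" "0 \<le> max l 0 * C" using K_pos C_pos by simp_all
  then have "0 \<le> K * (max l 0 * C)" by (rule mult_nonneg_nonneg)
  then have r: "r > 0" by (simp add: r_def)
  define b :: "('a \<Rightarrow>\<^sub>L real) \<Rightarrow> real" where "b = (\<lambda>\<phi>. r * \<bar>blinfun_apply \<phi> (y 0 0)\<bar>)"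
  have b: "b \<in> FBL" "\<And>\<phi>. b \<phi> \<ge> 0"
    unfolding b_def using r by (auto intro!: FBL_cmult abs_evaluation_in_FBL)
  define A where "A = range (\<lambda>m. inf b (level_sum m))"
  have "inf b (level_sum m) \<in> FBL" for m
    by (intro FBL_closed b(1) level_sum_in_FBL)
  then have "A \<subseteq> {a \<in> FBL. 0 \<le> a}"
    using b(2) level_sum_nonneg by (auto simp: A_def le_fun_def)
  then have "FBL_norm b \<le> ennreal l * (SUP a\<in>A. FBL_norm a)"
    using Fatou directed_up_inf_level_sum[of b] is_sup_in_FBL_inf_level_sum[OF b(1)]
    unfolding Fatou_property_def A_def by (meson conjI)
  also have "\<dots> \<le> ennreal (max l 0) * ennreal C"
    using FBL_norm_inf_level_sum_le[of b] b(2) by (intro mult_mono SUP_least) (auto simp: A_def ennreal_leI)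
  finally have le: "FBL_norm b \<le> ennreal (max l 0 * C)"
    using C_pos by (simp add: ennreal_mult)
  obtain \<phi> :: "'a \<Rightarrow>\<^sub>L real" where \<phi>: "norm \<phi> \<le> K" "blinfun_apply \<phi> (y 0 0) = 1"
    using functional_on_level[of "\<lambda>_. 1" 0] by auto
  have hom: "pos_homogeneous b" using b(1) by (simp add: FBL_def H1_def)
  have "ennreal r = ennreal \<bar>b \<phi>\<bar>" using r \<phi>(2) by (simp add: b_def)
  also have "\<dots> \<le> ennreal (norm \<phi>) * FBL_norm b"
    by (rule FBL_norm_bounds_values[OF hom])
  also have "\<dots> \<le> ennreal K * ennreal (max l 0 * C)"
    using le \<phi>(1) by (intro mult_mono ennreal_leI) auto
  also have "\<dots> = ennreal (K * (max l 0 * C))"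
    using K_pos C_pos by (intro ennreal_mult[symmetric]) auto
  finally have "r \<le> K * (max l 0 * C)"
    using K_pos C_pos by (subst (asm) ennreal_le_iff) auto
  then show False by (simp add: r_def)
qed

end

theorem theorem3p6:
  fixes l :: real
  assumes "l \<ge> 1"
    and "Fatou_property l (FBL :: (('a::banach \<Rightarrow>\<^sub>L real) \<Rightarrow> real) set) FBL_norm"
  shows "\<not> (\<exists>F :: 'a set. closed F \<and> isomorphic_subspace TYPE(L1_unit) F)"
proof
  assume "\<exists>F :: 'a set. closed F \<and> isomorphic_subspace TYPE(L1_unit) F"
  then obtain F :: "'a set" where "isomorphic_subspace TYPE(L1_unit) F" by blast
  then obtain y :: "nat \<Rightarrow> nat \<Rightarrow> 'a" and C K where "L1_tree y C K"
    by (rule L1_tree_in_isomorphic_copy)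
  then have "\<not> Fatou_property l (FBL :: (('a \<Rightarrow>\<^sub>L real) \<Rightarrow> real) set) FBL_norm"
    by (rule L1_tree.not_Fatou)
  then show False using assms(2) by (rule notE)
qed

end
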